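(* Let $D$ be a stable directed graph. Then $D$ is the compression of a preordered directed graph (that is, there exist a preordered directed graph $D_2$ and a compression map $\theta : V(D_2)\to V(D)$) if and only if every clasp in $D$ is unlocked.
   Context: Directed graphs have a finite set of vertices $V(D)$ and no repeated arrows, so the arrow set $A(D)$ is a set of ordered pairs of vertices; loops are allowed. An arrow from $v$ to $w$ is written $vw$. $D^{*}$ is the subgraph of $D$ with $V(D^{*})=V(D)$ and $A(D^{*})=\{xy\in A(D): x\neq y\}$ (loops removed). $D$ is reflexive if $vv\in A(D)$ for all $v\in V(D)$; transitive if $xy,yz\in A(D)$ implies $xz\in A(D)$ for all $x,y,z \in V(D)$; preordered if it is reflexive and transitive. The set of transitive triples is $\mathrm{Trans}(D)=\{(a,b,c): a,b,c\in V(D),\ ab,bc,ac\in A(D)\}$. Compression map: for reflexive directed graphs $D_1,D_2$, a compression map is a surjective function $\theta:V(D_2)\to V(D_1)$ such that (1) $\theta(x)\theta(y)\in A(D_1)$ for all $x,y\in V(D_2)$ with $xy\in A(D_2)$; (2) for every $(a_1,a_2,a_3)\in \mathrm{Trans}(D_1)$ there is $(x_1,x_2,x_3)\in \mathrm{Trans}(D_2)$ with $\theta(x_i)=a_i$ for $i=1,2,3$; (3) there is a (well-defined) bijection $\theta^{*}:A(D_2^{*})\to A(D_1^{*})$ given by $\theta^{*}(xy)=\theta(x)\theta(y)$ for all $xy\in A(D_2^{*})$. In this case $D_1$ is called a compression of $D_2$. A reflexive directed graph $D$ is balanced if for all $w,x,y,z\in V(D)$ (not necessarily distinct) with $wx,xy,yz,wz\in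 A(D)$ one has $wy\in A(D)$ if and only if $xz\in A(D)$. A reflexive directed graph $D$ is stable if it is balanced and $ad\in A(D)$ for all distinct $a,b,c,d\in V(D)$ with $ab,ac,bc,bd,cd\in A(D)$. Let $D$ be reflexive and $x\in V(D)$. $x$ is a clasp if there exist $w,y\in V(D)\setminus\{x\}$ with $wx,xy\in A(D)$ and $wy\notin A(D)$. $x$ is a locked clasp if there exist $u,v,w,y\in V(D)\setminus\{x\}$ with $(u,x,y),(u,x,v),(w,x,v)\in \mathrm{Trans}(D)$ and $wy\notin A(D)$. An unlocked clasp is a clasp that is not locked. *)

theory Defs
  imports "Graph_Theory.Pair_Digraph"
begin

text \<open>
  Finite directed graphs without repeated arrows, but possibly with loops, are the
  \<open>pair_fin_digraph\<close>s. Finiteness and well-formedness are built into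
  \<open>reflexive_digraph\<close>, and from there into all notions that presuppose reflexivity.
\<close>

definition reflexive_digraph :: "'a pair_pre_digraph \<Rightarrow> bool" where
  "reflexive_digraph D \<longleftrightarrow> pair_fin_digraph D \<and> (\<forall>v\<in>pverts D. (v, v) \<in> parcs D)"

definition transitive_digraph :: "'a pair_pre_digraph \<Rightarrow> bool" where
  "transitive_digraph D \<longleftrightarrow>
     (\<forall>x\<in>pverts D. \<forall>y\<in>pverts D. \<forall>z\<in>pverts D.
        (x, y) \<in> parcs D \<and> (y, z) \<in> parcs D \<longrightarrow> (x, z) \<in> parcs D)"

definition preordered_digraph :: "'a pair_pre_digraph \<Rightarrow> bool" where
  "preordered_digraph D \<longleftrightarrow> reflexive_digraph D \<and> transitive_digraph D"

definition remove_loops :: "'a pair_pre_digraph \<Rightarrow> 'a pair_pre_digraph" where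
  "remove_loops D = \<lparr> pverts = pverts D, parcs = {(x, y). (x, y) \<in> parcs D \<and> x \<noteq> y} \<rparr>"

definition Trans :: "'a pair_pre_digraph \<Rightarrow> ('a \<times> 'a \<times> 'a) set" where
  "Trans D = {(a, b, c). a \<in> pverts D \<and> b \<in> pverts D \<and> c \<in> pverts D \<and>
     (a, b) \<in> parcs D \<and> (b, c) \<in> parcs D \<and> (a, c) \<in> parcs D}"

text \<open>
  The map \<open>\<theta>\<close> goes from the vertices of the second graph \<open>D2\<close> to those of the first graph
  \<open>D1\<close>; only its values on \<open>pverts D2\<close> matter. In the last condition, \<open>bij_betw\<close> also says that
  \<open>\<theta>\<close> sends every non-loop of \<open>D2\<close> to a non-loop of \<open>D1\<close>.
\<close>

definition compression_map ::
    "'b pair_pre_digraph \<Rightarrow> 'a pair_pre_digraph \<Rightarrow> ('b \<Rightarrow> 'a) \<Rightarrow> bool" where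
  "compression_map D2 D1 \<theta> \<longleftrightarrow>
     reflexive_digraph D1 \<and> reflexive_digraph D2 \<and>
     \<theta> ` pverts D2 = pverts D1 \<and>
     (\<forall>x\<in>pverts D2. \<forall>y\<in>pverts D2. (x, y) \<in> parcs D2 \<longrightarrow> (\<theta> x, \<theta> y) \<in> parcs D1) \<and>
     (\<forall>a1 a2 a3. (a1, a2, a3) \<in> Trans D1 \<longrightarrow>
        (\<exists>x1 x2 x3. (x1, x2, x3) \<in> Trans D2 \<and> \<theta> x1 = a1 \<and> \<theta> x2 = a2 \<and> \<theta> x3 = a3)) \<and>
     bij_betw (\<lambda>(x, y). (\<theta> x, \<theta> y)) (parcs (remove_loops D2)) (parcs (remove_loops D1))"

definition balanced_digraph :: "'a pair_pre_digraph \<Rightarrow> bool" where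
  "balanced_digraph D \<longleftrightarrow> reflexive_digraph D \<and>
     (\<forall>w\<in>pverts D. \<forall>x\<in>pverts D. \<forall>y\<in>pverts D. \<forall>z\<in>pverts D.
        (w, x) \<in> parcs D \<and> (x, y) \<in> parcs D \<and> (y, z) \<in> parcs D \<and> (w, z) \<in> parcs D \<longrightarrow>
        ((w, y) \<in> parcs D \<longleftrightarrow> (x, z) \<in> parcs D))"

definition stable_digraph :: "'a pair_pre_digraph \<Rightarrow> bool" where
  "stable_digraph D \<longleftrightarrow> balanced_digraph D \<and>
     (\<forall>a\<in>pverts D. \<forall>b\<in>pverts D. \<forall>c\<in>pverts D. \<forall>d\<in>pverts D.
        distinct [a, b, c, d] \<and> (a, b) \<in> parcs D \<and> (a, c) \<in> parcs D \<and>
        (b, c) \<in> parcs D \<and> (b, d) \<in> parcs D \<and> (c, d) \<in> parcs D \<longrightarrow>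
        (a, d) \<in> parcs D)"

definition clasp :: "'a pair_pre_digraph \<Rightarrow> 'a \<Rightarrow> bool" where
  "clasp D x \<longleftrightarrow>
     (\<exists>w\<in>pverts D - {x}. \<exists>y\<in>pverts D - {x}.
        (w, x) \<in> parcs D \<and> (x, y) \<in> parcs D \<and> (w, y) \<notin> parcs D)"

definition locked_clasp :: "'a pair_pre_digraph \<Rightarrow> 'a \<Rightarrow> bool" where
  "locked_clasp D x \<longleftrightarrow>
     (\<exists>u\<in>pverts D - {x}. \<exists>v\<in>pverts D - {x}. \<exists>w\<in>pverts D - {x}. \<exists>y\<in>pverts D - {x}.
        (u, x, y) \<in> Trans D \<and> (u, x, v) \<in> Trans D \<and> (w, x, v) \<in> Trans D \<and>
        (w, y) \<notin> parcs D)"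

definition unlocked_clasp :: "'a pair_pre_digraph \<Rightarrow> 'a \<Rightarrow> bool" where
  "unlocked_clasp D x \<longleftrightarrow> clasp D x \<and> \<not> locked_clasp D x"

text \<open>
  An existential quantifier cannot range over types, so the vertices of a preordered graph of
  which a given graph is the compression are taken to be natural numbers. As the graphs are
  finite, this loses nothing:
\<close>

lemma compression_of_preordered_nat:
  fixes E :: "'b pair_pre_digraph" and D :: "'a pair_pre_digraph"
  assumes pre: "preordered_digraph E" and comp: "compression_map E D \<theta>"
  shows "\<exists>(D2 :: nat pair_pre_digraph) \<eta>. preordered_digraph D2 \<and> compression_map D2 D \<eta>"
proof -
  have refl: "\<And>v. v \<in> pverts E \<Longrightarrow> (v, v) \<in> parcs E" and fin: "pair_fin_digraph E"
    using pre by (auto simp: preordered_digraph_def reflexive_digraph_def)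
  interpret pair_fin_digraph E by (rule fin)
  obtain f :: "'b \<Rightarrow> nat" where f: "inj_on f (pverts E)"
    using finite_imp_inj_to_nat_seg[OF pair_finite_verts] by auto
  define g where "g = inv_into (pverts E) f"
  have g: "g (f v) = v" if "v \<in> pverts E" for v
    using that f by (simp add: g_def)
  define D2 where "D2 = \<lparr> pverts = f ` pverts E, parcs = map_prod f f ` parcs E \<rparr>"
  have V: "pverts D2 = f ` pverts E" by (simp add: D2_def)
  have A: "(f x, f y) \<in> parcs D2 \<longleftrightarrow> (x, y) \<in> parcs E"
    if "x \<in> pverts E" "y \<in> pverts E" for x y
    using that f by (auto simp: D2_def dest: inj_onD in_arcsD1 in_arcsD2)
  have finD2: "pair_fin_digraph D2"
    by unfold_locales
      (auto simp: D2_def pair_finite_verts pair_finite_arcs dest: in_arcsD1 in_arcsD2)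
  have reflD2: "reflexive_digraph D2"
    using finD2 refl by (auto simp: reflexive_digraph_def V A)
  have preD2: "preordered_digraph D2"
  proof -
    have tr: "\<forall>x\<in>pverts E. \<forall>y\<in>pverts E. \<forall>z\<in>pverts E.
        (x, y) \<in> parcs E \<and> (y, z) \<in> parcs E \<longrightarrow> (x, z) \<in> parcs E"
      using pre unfolding preordered_digraph_def transitive_digraph_def by blast
    have "transitive_digraph D2"
      unfolding transitive_digraph_def
    proof (intro ballI impI)
      fix x y z assume "x \<in> pverts D2" "y \<in> pverts D2" "z \<in> pverts D2"
      then obtain a b c where abc: "a \<in> pverts E" "b \<in> pverts E" "c \<in> pverts E"
        "x = f a" "y = f b" "z = f c"
        unfolding V by blast
      assume "(x, y) \<in> parcs D2 \<and> (y, z) \<in> parcs D2"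
      then have "(a, b) \<in> parcs E" "(b, c) \<in> parcs E" using abc A by blast+
      then show "(x, z) \<in> parcs D2" using abc A tr by blast
    qed
    with reflD2 show ?thesis by (simp add: preordered_digraph_def)
  qed
  have T: "(f x, f y, f z) \<in> Trans D2" if "(x, y, z) \<in> Trans E" for x y z
    using that by (auto simp: Trans_def V A)
  have surj: "(\<theta> \<circ> g) ` pverts D2 = pverts D"
  proof -
    have "\<theta> ` pverts E = pverts D" using comp unfolding compression_map_def by blast
    then show ?thesis by (simp add: V g image_image)
  qed
  have c1: "\<forall>x\<in>pverts D2. \<forall>y\<in>pverts D2.
      (x, y) \<in> parcs D2 \<longrightarrow> ((\<theta> \<circ> g) x, (\<theta> \<circ> g) y) \<in> parcs D"
  proof -
    have "\<forall>x\<in>pverts E. \<forall>y\<in>pverts E. (x, y) \<in> parcs E \<longrightarrow> (\<theta> x, \<theta> y) \<in> parcs D"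
      using comp unfolding compression_map_def by blast
    then show ?thesis by (simp add: V A g)
  qed
  have c2: "\<exists>x1 x2 x3. (x1, x2, x3) \<in> Trans D2 \<and>
      (\<theta> \<circ> g) x1 = a1 \<and> (\<theta> \<circ> g) x2 = a2 \<and> (\<theta> \<circ> g) x3 = a3"
    if a: "(a1, a2, a3) \<in> Trans D" for a1 a2 a3
  proof -
    from a comp obtain x1 x2 x3 where x: "(x1, x2, x3) \<in> Trans E"
      "\<theta> x1 = a1" "\<theta> x2 = a2" "\<theta> x3 = a3"
      unfolding compression_map_def by blast
    then have "x1 \<in> pverts E" "x2 \<in> pverts E" "x3 \<in> pverts E" by (auto simp: Trans_def)
    then show ?thesis using x T
      by (intro exI[of _ "f x1"] exI[of _ "f x2"] exI[of _ "f x3"]) (simp add: g)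
  qed
  have sub: "parcs (remove_loops D2) = map_prod f f ` parcs (remove_loops E)"
    using f by (auto simp: remove_loops_def D2_def dest: inj_onD in_arcsD1 in_arcsD2)
  have gA: "g (f x) = x" "g (f y) = y" if "(x, y) \<in> parcs E" for x y
    using that by (auto intro: g dest: in_arcsD1 in_arcsD2)
  have "bij_betw (map_prod g g) (parcs (remove_loops D2)) (parcs (remove_loops E))"
    unfolding sub
    by (rule bij_betw_byWitness[where f' = "map_prod f f"])
      (auto simp: remove_loops_def gA)
  moreover have "bij_betw (\<lambda>(x, y). (\<theta> x, \<theta> y)) (parcs (remove_loops E)) (parcs (remove_loops D))"
    using comp by (simp add: compression_map_def)
  ultimately have "bij_betw ((\<lambda>(x, y). (\<theta> x, \<theta> y)) \<circ> map_prod g g)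
      (parcs (remove_loops D2)) (parcs (remove_loops D))"
    by (rule bij_betw_trans)
  moreover have "(\<lambda>(x, y). (\<theta> x, \<theta> y)) \<circ> map_prod g g =
      (\<lambda>(x, y). ((\<theta> \<circ> g) x, (\<theta> \<circ> g) y))"
    by auto
  ultimately have c3: "bij_betw (\<lambda>(x, y). ((\<theta> \<circ> g) x, (\<theta> \<circ> g) y))
      (parcs (remove_loops D2)) (parcs (remove_loops D))"
    by simp
  have "compression_map D2 D (\<theta> \<circ> g)"
  proof -
    have "reflexive_digraph D" using comp unfolding compression_map_def by blast
    then show ?thesis
      unfolding compression_map_def using reflD2 surj c1 c2 c3 by (intro conjI allI impI)
  qed
  with preD2 show ?thesis by blast
qed

end

theory Submission
  imports Defs
begin

text \<open>
  A compression map lifts every non-loop uniquely, so the three transitive triples of a locked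
  clasp \<open>x\<close> lift to triples through one and the same vertex over \<open>x\<close>; transitivity upstairs then
  gives the missing arrow \<open>wy\<close>.

  Conversely, split every vertex \<open>x\<close> into copies, one for each class of the non-loops at \<open>x\<close>
  under the equivalence relation generated by lying in a common transitive triple. If \<open>D\<close> is
  stable without locked clasps, then all arrows \<open>ux\<close> into \<open>x\<close> within a class have the same set
  of out-neighbours \<open>v\<close> of \<open>x\<close> with \<open>uv\<close> an arrow, and this set contains the heads of all arrows
  \<open>xv\<close> of the class. Hence the graph of the copies is transitive.
\<close>

section \<open>Working rules for reflexive, balanced and stable graphs and for clasps\<close>

lemma arcs_in_verts:
  assumes "reflexive_digraph D" "(x, y) \<in> parcs D"
  shows "x \<in> pverts D" "y \<in> pverts D"
proof -
  interpret pair_fin_digraph D using assms(1) by (simp add: reflexive_digraph_def)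
  show "x \<in> pverts D" "y \<in> pverts D" using assms(2) by (auto dest: in_arcsD1 in_arcsD2)
qed

lemma reflexive_digraph_loop:
  "reflexive_digraph D \<Longrightarrow> x \<in> pverts D \<Longrightarrow> (x, x) \<in> parcs D"
  by (simp add: reflexive_digraph_def)

lemma Trans_iff:
  assumes "reflexive_digraph D"
  shows "(a, b, c) \<in> Trans D \<longleftrightarrow> (a, b) \<in> parcs D \<and> (b, c) \<in> parcs D \<and> (a, c) \<in> parcs D"
  using arcs_in_verts[OF assms] by (auto simp: Trans_def)

lemma stable_imp_balanced: "stable_digraph D \<Longrightarrow> balanced_digraph D"
  by (simp add: stable_digraph_def)

lemma balanced_imp_reflexive: "balanced_digraph D \<Longrightarrow> reflexive_digraph D"
  by (simp add: balanced_digraph_def)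

lemmas stable_imp_reflexive = balanced_imp_reflexive[OF stable_imp_balanced]

lemma balanced_digraphD:
  assumes "balanced_digraph D"
    and "(w, x) \<in> parcs D" "(x, y) \<in> parcs D" "(y, z) \<in> parcs D" "(w, z) \<in> parcs D"
  shows "(w, y) \<in> parcs D \<longleftrightarrow> (x, z) \<in> parcs D"
  using assms arcs_in_verts[OF balanced_imp_reflexive[OF assms(1)]]
  unfolding balanced_digraph_def by blast

text \<open>If two of the four vertices coincide, \<open>(a, d)\<close> is a loop or one of the
  assumed arrows, except when \<open>b = c\<close>. So \<open>b\<close> and \<open>c\<close> are the
  only pair that must be kept apart.\<close>

lemma stable_digraphD:
  assumes D: "stable_digraph D" and bc: "b \<noteq> c"
    and arcs: "(a, b) \<in> parcs D" "(a, c) \<in> parcs D" "(b, c) \<in> parcs D"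
      "(b, d) \<in> parcs D" "(c, d) \<in> parcs D"
  shows "(a, d) \<in> parcs D"
proof (cases "distinct [a, b, c, d]")
  case True
  then show ?thesis
    using D arcs arcs_in_verts[OF stable_imp_reflexive[OF D]] unfolding stable_digraph_def by blast
next
  case False
  then consider "a = b" | "a = c" | "a = d" | "b = d" | "c = d" using bc by auto
  then show ?thesis
  proof cases
    case 3
    then show ?thesis
      using arcs arcs_in_verts(1) reflexive_digraph_loop stable_imp_reflexive[OF D] by metis
  qed (use arcs in auto)
qed

lemma not_locked_claspD:
  assumes D: "reflexive_digraph D" and "\<not> locked_clasp D x"
    and "u \<noteq> x" "v \<noteq> x" "w \<noteq> x" "y \<noteq> x"
    and "(u, x) \<in> parcs D" "(w, x) \<in> parcs D" "(x, y) \<in> parcs D" "(x, v) \<in> parcs D"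
    and "(u, y) \<in> parcs D" "(u, v) \<in> parcs D" "(w, v) \<in> parcs D"
  shows "(w, y) \<in> parcs D"
  using assms(2-) arcs_in_verts[OF D] unfolding locked_clasp_def Trans_iff[OF D] by blast

text \<open>The arrows \<open>wx\<close> and \<open>xy\<close> of a locked configuration already
  witness a clasp. Hence "every clasp is unlocked" amounts to "no vertex is a locked clasp".\<close>

lemma locked_clasp_imp_clasp: "locked_clasp D x \<Longrightarrow> clasp D x"
  by (auto simp: locked_clasp_def clasp_def Trans_def)


section \<open>Compressions of preordered graphs\<close>

text \<open>Distinct images force both arrows to be non-loops upstairs, where the arrow map is
  injective.\<close>

lemma compression_arc_lift_unique:
  assumes "compression_map E D \<theta>"
    and "(x, y) \<in> parcs E" "(x', y') \<in> parcs E"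
    and "\<theta> x = \<theta> x'" "\<theta> y = \<theta> y'" "\<theta> x \<noteq> \<theta> y"
  shows "x = x' \<and> y = y'"
proof -
  have "inj_on (\<lambda>(x, y). (\<theta> x, \<theta> y)) (parcs (remove_loops E))"
    using assms(1) by (simp add: compression_map_def bij_betw_def)
  from inj_onD[OF this, of "(x, y)" "(x', y')"] show ?thesis
    using assms(2-) by (force simp: remove_loops_def)
qed

lemma compression_of_preordered_not_locked_clasp:
  assumes E: "preordered_digraph E" and comp: "compression_map E D \<theta>"
  shows "\<not> locked_clasp D x"
proof
  assume "locked_clasp D x"
  then obtain u v w y where ne: "u \<noteq> x" "v \<noteq> x" "w \<noteq> x" "y \<noteq> x"
    and t: "(u, x, y) \<in> Trans D" "(u, x, v) \<in> Trans D" "(w, x, v) \<in> Trans D"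
    and wy: "(w, y) \<notin> parcs D"
    unfolding locked_clasp_def by blast
  have lift: "\<exists>x1 x2 x3. (x1, x2, x3) \<in> Trans E \<and> \<theta> x1 = a \<and> \<theta> x2 = b \<and> \<theta> x3 = c"
    if "(a, b, c) \<in> Trans D" for a b c
    using comp that unfolding compression_map_def by blast
  obtain u1 x1 y1 where 1: "(u1, x1, y1) \<in> Trans E" "\<theta> u1 = u" "\<theta> x1 = x" "\<theta> y1 = y"
    using lift[OF t(1)] by blast
  obtain u2 x2 v2 where 2: "(u2, x2, v2) \<in> Trans E" "\<theta> u2 = u" "\<theta> x2 = x" "\<theta> v2 = v"
    using lift[OF t(2)] by blast
  obtain w3 x3 v3 where 3: "(w3, x3, v3) \<in> Trans E" "\<theta> w3 = w" "\<theta> x3 = x" "\<theta> v3 = v"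
    using lift[OF t(3)] by blast
  \<comment> \<open>The first two triples both lift \<open>ux\<close>, the last two both lift
    \<open>xv\<close>.\<close>
  have "x1 = x2"
    using compression_arc_lift_unique[OF comp, of u1 x1 u2 x2] 1 2 ne by (auto simp: Trans_def)
  moreover have "x2 = x3"
    using compression_arc_lift_unique[OF comp, of x2 v2 x3 v3] 2 3 ne by (auto simp: Trans_def)
  ultimately have "(w3, x1) \<in> parcs E" "(x1, y1) \<in> parcs E"
    and V: "w3 \<in> pverts E" "x1 \<in> pverts E" "y1 \<in> pverts E"
    using 1 3 by (auto simp: Trans_def)
  then have "(w3, y1) \<in> parcs E"
    using E unfolding preordered_digraph_def transitive_digraph_def by blast
  then have "(\<theta> w3, \<theta> y1) \<in> parcs D"
    using comp V unfolding compression_map_def by blast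
  with wy 1 3 show False by simp
qed


section \<open>Splitting the vertices\<close>

text \<open>The vertices of the triple may coincide: in a reflexive graph \<open>(a, b, a)\<close>
  makes opposite arrows adjacent at both of their ends.\<close>

definition adjacent_at :: "'a pair_pre_digraph \<Rightarrow> 'a \<Rightarrow> 'a \<times> 'a \<Rightarrow> 'a \<times> 'a \<Rightarrow> bool" where
  "adjacent_at D x e e' \<longleftrightarrow>
     (\<exists>a b c. (a, b, c) \<in> Trans D \<and> {e, e'} \<subseteq> {(a, b), (b, c), (a, c)} \<and>
        fst e \<noteq> snd e \<and> fst e' \<noteq> snd e' \<and>
        x \<in> {fst e, snd e} \<and> x \<in> {fst e', snd e'})"

abbreviation linked_at :: "'a pair_pre_digraph \<Rightarrow> 'a \<Rightarrow> 'a \<times> 'a \<Rightarrow> 'a \<times> 'a \<Rightarrow> bool" where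
  "linked_at D x \<equiv> (adjacent_at D x)\<^sup>*\<^sup>*"

text \<open>A reflexive closure relates every pair to itself, even a pair that is no arrow;
  restricting to \<open>parcs D\<close> makes each class an element of the finite set
  \<open>Pow (parcs D)\<close>.\<close>

definition arc_class :: "'a pair_pre_digraph \<Rightarrow> 'a \<Rightarrow> 'a \<times> 'a \<Rightarrow> ('a \<times> 'a) set" where
  "arc_class D x e = {e' \<in> parcs D. linked_at D x e e'}"

lemma adjacent_at_sym: "adjacent_at D x e e' \<Longrightarrow> adjacent_at D x e' e"
  unfolding adjacent_at_def by blast

lemma linked_at_sym: "linked_at D x e e' \<Longrightarrow> linked_at D x e' e"
  by (rule sympD[OF symp_rtranclp]) (auto intro: sympI adjacent_at_sym)

lemma arc_class_eq_iff:
  assumes "e' \<in> parcs D"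
  shows "arc_class D x e = arc_class D x e' \<longleftrightarrow> linked_at D x e e'"
proof
  assume "arc_class D x e = arc_class D x e'"
  with assms show "linked_at D x e e'" by (auto simp: arc_class_def)
next
  assume "linked_at D x e e'"
  then show "arc_class D x e = arc_class D x e'"
    unfolding arc_class_def by (auto intro: rtranclp_trans linked_at_sym)
qed

lemma arc_class_eqI:
  assumes "(a, b, c) \<in> Trans D" "{e, e'} \<subseteq> {(a, b), (b, c), (a, c)}"
    and "fst e \<noteq> snd e" "fst e' \<noteq> snd e'" "x \<in> {fst e, snd e}" "x \<in> {fst e', snd e'}"
  shows "arc_class D x e = arc_class D x e'"
proof -
  have "adjacent_at D x e e'" using assms unfolding adjacent_at_def by blast
  moreover have "e' \<in> parcs D" using assms(1,2) by (auto simp: Trans_def)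
  ultimately show ?thesis by (simp add: arc_class_eq_iff r_into_rtranclp)
qed

text \<open>Triples are sorted by whether \<open>x\<close> is their middle, last or first
  vertex.\<close>

lemma adjacent_at_cases:
  assumes D: "reflexive_digraph D" and "adjacent_at D x e e'"
  obtains "e = e'"
  | p q where "p \<noteq> x" "q \<noteq> x" "(p, q) \<in> parcs D" "(p, x) \<in> parcs D" "(x, q) \<in> parcs D"
      "{e, e'} = {(p, x), (x, q)}"
  | p q where "p \<noteq> x" "q \<noteq> x" "(p, q) \<in> parcs D" "(p, x) \<in> parcs D" "(q, x) \<in> parcs D"
      "{e, e'} = {(p, x), (q, x)}"
  | p q where "p \<noteq> x" "q \<noteq> x" "(p, q) \<in> parcs D" "(x, p) \<in> parcs D" "(x, q) \<in> parcs D"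
      "{e, e'} = {(x, p), (x, q)}"
proof -
  from assms(2) obtain a b c where
    t: "(a, b) \<in> parcs D" "(b, c) \<in> parcs D" "(a, c) \<in> parcs D" "b \<in> pverts D"
    and e: "{e, e'} \<subseteq> {(a, b), (b, c), (a, c)}" "fst e \<noteq> snd e" "fst e' \<noteq> snd e'"
      "x \<in> {fst e, snd e}" "x \<in> {fst e', snd e'}"
    unfolding adjacent_at_def Trans_def by blast
  show thesis
  proof (cases "e = e'")
    case False
    then consider "{e, e'} = {(a, b), (b, c)}" | "{e, e'} = {(a, b), (a, c)}"
      | "{e, e'} = {(b, c), (a, c)}"
      using e(1) by blast
    then show thesis
    proof cases
      case 1
      then have ne: "a \<noteq> b" "b \<noteq> c" and x: "x = b \<or> x = a \<and> a = c"
        using e by (auto simp: doubleton_eq_iff)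
      show thesis
      proof (cases "x = b")
        case True
        with 1 t ne show thesis by (intro that(2)[of a c]) auto
      next
        case False
        \<comment> \<open>The triple \<open>(x, b, x)\<close> is replaced by
          \<open>(b, x, b)\<close>, which has \<open>x\<close> in the middle; its third arrow is the
          loop at \<open>b\<close>.\<close>
        with 1 t ne x show thesis by (intro that(2)[of b b]) (auto intro: reflexive_digraph_loop[OF D])
      qed
    next
      case 2
      then have "a \<noteq> b" "a \<noteq> c" "x = a"
        using e False by (auto simp: doubleton_eq_iff)
      with 2 t show thesis by (intro that(4)[of b c]) auto
    next
      case 3
      then have "b \<noteq> c" "a \<noteq> c" "x = c"
        using e False by (auto simp: doubleton_eq_iff)
      with 3 t show thesis by (intro that(3)[of a b]) auto
    qed
  qed (rule that)
qed

lemma linked_at_imp_arc: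
  assumes D: "stable_digraph D" and unlocked: "\<not> locked_clasp D x"
    and ax: "(a, x) \<in> parcs D" "a \<noteq> x"
    and linked: "linked_at D x (a, x) (x, b)" and "x \<noteq> b"
  shows "(a, b) \<in> parcs D"
proof -
  note refl = stable_imp_reflexive[OF D]
  define same where "same p \<longleftrightarrow> p \<noteq> x \<and> (p, x) \<in> parcs D \<and>
    (\<forall>v. v \<noteq> x \<longrightarrow> (x, v) \<in> parcs D \<longrightarrow> ((p, v) \<in> parcs D \<longleftrightarrow> (a, v) \<in> parcs D))" for p
  define out where "out q \<longleftrightarrow> q \<noteq> x \<and> (x, q) \<in> parcs D \<and> (a, q) \<in> parcs D" for q
  \<comment> \<open>A chain may alternate between arrows into and out of \<open>x\<close>, so the
    invariant has a clause for each kind.\<close>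
  define inv where "inv e \<longleftrightarrow> (\<exists>p. e = (p, x) \<and> same p) \<or> (\<exists>q. e = (x, q) \<and> out q)" for e
  have inv_in: "inv (p, x) \<longleftrightarrow> same p" and inv_out: "inv (x, p) \<longleftrightarrow> out p" if "p \<noteq> x" for p
    using that by (auto simp: inv_def)
  have "inv e" if "linked_at D x (a, x) e" for e
    using that
  proof (induction rule: rtranclp_induct)
    case base
    show ?case using ax by (auto simp: inv_def same_def)
  next
    case (step e e')
    from refl step.hyps(2) show ?case
    proof (cases rule: adjacent_at_cases)
      case 1
      with step.IH show ?thesis by simp
    next
      case (2 p q)
      have "same p \<longleftrightarrow> out q"
      proof
        assume "same p"
        with 2(1-5) show "out q" unfolding same_def out_def by blast
      next
        assume "out q"
        then have aq: "(a, q) \<in> parcs D" by (simp add: out_def)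
        \<comment> \<open>The arrows \<open>aq\<close> and \<open>pq\<close> share the out-neighbour
          \<open>q\<close> of \<open>x\<close>. As \<open>x\<close> is not a locked clasp,
          \<open>av\<close> then yields \<open>pv\<close>; exchanging \<open>a\<close> and
          \<open>p\<close> gives the converse.\<close>
        have "(p, v) \<in> parcs D \<longleftrightarrow> (a, v) \<in> parcs D" if "v \<noteq> x" "(x, v) \<in> parcs D" for v
          using not_locked_claspD[OF refl unlocked, of a q p v]
            not_locked_claspD[OF refl unlocked, of p q a v] that 2(1-5) ax aq by blast
        with 2(1-5) show "same p" by (simp add: same_def)
      qed
      moreover have "e = (p, x) \<and> e' = (x, q) \<or> e = (x, q) \<and> e' = (p, x)"
        using 2(6) by (simp add: doubleton_eq_iff)
      ultimately show ?thesis
        using step.IH inv_in[OF 2(1)] inv_out[OF 2(2)] by blast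
    next
      case (3 p q)
      \<comment> \<open>Balance along \<open>p, q, x, v\<close> turns \<open>pv\<close> into
        \<open>qv\<close>; stability gives the converse.\<close>
      have "(p, v) \<in> parcs D \<longleftrightarrow> (q, v) \<in> parcs D" if "v \<noteq> x" "(x, v) \<in> parcs D" for v
        using balanced_digraphD[OF stable_imp_balanced[OF D], of p q x v]
          stable_digraphD[OF D, of q x p v] that 3(1-5) by blast
      then have "same p \<longleftrightarrow> same q" using 3(1-5) by (simp add: same_def)
      moreover have "e = (p, x) \<and> e' = (q, x) \<or> e = (q, x) \<and> e' = (p, x)"
        using 3(6) by (simp add: doubleton_eq_iff)
      ultimately show ?thesis
        using step.IH inv_in[OF 3(1)] inv_in[OF 3(2)] by blast
    next
      case (4 p q)
      \<comment> \<open>Here stability gives the forward direction, and balance along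
        \<open>a, x, p, q\<close> the backward one.\<close>
      have "(a, p) \<in> parcs D \<longleftrightarrow> (a, q) \<in> parcs D"
        using balanced_digraphD[OF stable_imp_balanced[OF D], of a x p q]
          stable_digraphD[OF D, of x p a q] 4(1-5) ax by blast
      then have "out p \<longleftrightarrow> out q" using 4(1-5) by (simp add: out_def)
      moreover have "e = (x, p) \<and> e' = (x, q) \<or> e = (x, q) \<and> e' = (x, p)"
        using 4(6) by (simp add: doubleton_eq_iff)
      ultimately show ?thesis
        using step.IH inv_out[OF 4(1)] inv_out[OF 4(2)] by blast
    qed
  qed
  from this[OF linked] have "out b" using inv_out[of b] \<open>x \<noteq> b\<close> by simp
  then show ?thesis by (simp add: out_def)
qed

section \<open>The graph of the copies and its projection\<close>

text \<open>All sets of arrows are allowed as second components; those which are not classes give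
  isolated copies of their vertex.\<close>

definition split_arc :: "'a pair_pre_digraph \<Rightarrow> 'a \<times> 'a \<Rightarrow>
    ('a \<times> ('a \<times> 'a) set) \<times> ('a \<times> ('a \<times> 'a) set)" where
  "split_arc D e = ((fst e, arc_class D (fst e) e), (snd e, arc_class D (snd e) e))"

definition split_digraph ::
    "'a pair_pre_digraph \<Rightarrow> ('a \<times> ('a \<times> 'a) set) pair_pre_digraph" where
  "split_digraph D =
     \<lparr> pverts = pverts D \<times> Pow (parcs D),
       parcs = (\<lambda>p. (p, p)) ` (pverts D \<times> Pow (parcs D)) \<union> split_arc D ` parcs (remove_loops D) \<rparr>"

lemma split_digraph_arcE:
  assumes "(P, Q) \<in> parcs (split_digraph D)"
  obtains "P = Q"
  | x y where "(x, y) \<in> parcs D" "x \<noteq> y"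
      "P = (x, arc_class D x (x, y))" "Q = (y, arc_class D y (x, y))"
proof -
  from assms consider "P = Q" | e where "e \<in> parcs (remove_loops D)" "(P, Q) = split_arc D e"
    by (auto simp: split_digraph_def)
  then show thesis
  proof cases
    case 2
    then show thesis
      using that(2)[of "fst e" "snd e"] by (simp add: split_arc_def remove_loops_def split_beta)
  qed (rule that(1))
qed

lemma split_digraph_arcI:
  "(x, y) \<in> parcs D \<Longrightarrow> x \<noteq> y \<Longrightarrow>
    ((x, arc_class D x (x, y)), (y, arc_class D y (x, y))) \<in> parcs (split_digraph D)"
  by (auto simp: split_digraph_def split_arc_def remove_loops_def image_iff)

lemma reflexive_split_digraph:
  assumes D: "reflexive_digraph D"
  shows "reflexive_digraph (split_digraph D)"
proof -
  interpret pair_fin_digraph D using D by (simp add: reflexive_digraph_def)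
  have "finite (parcs (remove_loops D))"
    by (rule finite_subset[OF _ pair_finite_arcs]) (auto simp: remove_loops_def)
  then have "pair_fin_digraph (split_digraph D)"
    using pair_finite_verts pair_finite_arcs
    by unfold_locales
      (auto simp: split_digraph_def split_arc_def remove_loops_def arc_class_def
        dest: in_arcsD1 in_arcsD2)
  then show ?thesis by (auto simp: reflexive_digraph_def split_digraph_def)
qed

lemma preordered_split_digraph:
  assumes D: "stable_digraph D" and unlocked: "\<And>x. x \<in> pverts D \<Longrightarrow> \<not> locked_clasp D x"
  shows "preordered_digraph (split_digraph D)"
proof -
  note refl = stable_imp_reflexive[OF D]
  have "(P, R) \<in> parcs (split_digraph D)"
    if PQ: "(P, Q) \<in> parcs (split_digraph D)" and QR: "(Q, R) \<in> parcs (split_digraph D)" for P Q R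
    using PQ
  proof (cases rule: split_digraph_arcE)
    case 1
    with QR show ?thesis by simp
  next
    case ax: (2 a x)
    from QR show ?thesis
    proof (cases rule: split_digraph_arcE)
      case 1
      with PQ show ?thesis by simp
    next
      case xb: (2 x' b)
      then have [simp]: "x' = x" using ax by simp
      \<comment> \<open>Both arrows meet at the same copy \<open>Q\<close> of \<open>x\<close>, so
        their classes at \<open>x\<close> are equal.\<close>
      have "linked_at D x (a, x) (x, b)"
        using ax xb by (simp flip: arc_class_eq_iff)
      then have "(a, b) \<in> parcs D"
        using linked_at_imp_arc[OF D unlocked, of x a b] arcs_in_verts(1)[OF refl xb(1)] ax xb
        by simp
      then have t: "(a, x, b) \<in> Trans D" using ax xb by (simp add: Trans_iff[OF refl])
      show ?thesis
      proof (cases "a = b")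
        case True
        \<comment> \<open>A path that returns over \<open>a\<close> ends at the copy where it began,
          so the required arrow is a loop.\<close>
        have "arc_class D a (a, x) = arc_class D a (x, b)"
          by (rule arc_class_eqI[OF t]; use True ax xb in simp)
        with True ax xb have "P = R" by simp
        moreover have "P \<in> pverts (split_digraph D)"
          using PQ arcs_in_verts[OF reflexive_split_digraph[OF refl]] by blast
        ultimately show ?thesis
          using reflexive_digraph_loop[OF reflexive_split_digraph[OF refl]] by simp
      next
        case False
        \<comment> \<open>The triple \<open>(a, x, b)\<close> shows that the lift of
          \<open>ab\<close> runs from \<open>P\<close> to \<open>R\<close>.\<close>
        have "arc_class D a (a, x) = arc_class D a (a, b)"
          "arc_class D b (x, b) = arc_class D b (a, b)"
          by (rule arc_class_eqI[OF t]; use False ax xb in simp)+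
        with False ax xb \<open>(a, b) \<in> parcs D\<close> show ?thesis by (simp add: split_digraph_arcI)
      qed
    qed
  qed
  then show ?thesis
    using reflexive_split_digraph[OF refl]
    unfolding preordered_digraph_def transitive_digraph_def by blast
qed

lemma compression_map_split_digraph:
  assumes D: "reflexive_digraph D"
  shows "compression_map (split_digraph D) D fst"
proof -
  let ?E = "split_digraph D"
  note refl = reflexive_split_digraph[OF D]
  \<comment> \<open>The empty set is always an admissible second component, so a vertex without
    non-loops has a copy too.\<close>
  have surj: "fst ` pverts ?E = pverts D"
    by (force simp: split_digraph_def)
  have hom: "(fst P, fst Q) \<in> parcs D" if "P \<in> pverts ?E" "(P, Q) \<in> parcs ?E" for P Q
    using that(2)
  proof (cases rule: split_digraph_arcE)
    case 1
    with that(1) surj show ?thesis using reflexive_digraph_loop[OF D] by auto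
  qed simp
  have lift: "\<exists>P Q R. (P, Q, R) \<in> Trans ?E \<and> fst P = a \<and> fst Q = b \<and> fst R = c"
    if t: "(a, b, c) \<in> Trans D" for a b c
  proof -
    let ?p = "\<lambda>x e. (x, arc_class D x e)"
    have arcs: "(a, b) \<in> parcs D" "(b, c) \<in> parcs D" "(a, c) \<in> parcs D"
      using t by (auto simp: Trans_iff[OF D])
    have loop: "(?p x e, ?p x e) \<in> parcs ?E" if "x \<in> {a, b, c}" for x e
      using that t by (auto simp: split_digraph_def arc_class_def Trans_def)
    \<comment> \<open>Degenerate triples lift by loops and at most one non-loop, or by a pair of
      opposite arrows; for distinct vertices the triple itself makes the classes agree at each
      corner.\<close>
    consider "a = b" "b = c" | "a = b" "b \<noteq> c" | "a \<noteq> b" "b = c" | "a = c" "a \<noteq> b"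
      | "a \<noteq> b" "b \<noteq> c" "a \<noteq> c" by blast
    then have "\<exists>e f g. (?p a e, ?p b f, ?p c g) \<in> Trans ?E"
    proof cases
      case 1
      then have "(?p a (a, b), ?p b (a, b), ?p c (a, b)) \<in> Trans ?E"
        using loop by (simp add: Trans_iff[OF refl])
      then show ?thesis by blast
    next
      case 2
      then have "(?p a (b, c), ?p b (b, c), ?p c (b, c)) \<in> Trans ?E"
        using loop split_digraph_arcI[OF arcs(2)] by (simp add: Trans_iff[OF refl])
      then show ?thesis by blast
    next
      case 3
      then have "(?p a (a, b), ?p b (a, b), ?p c (a, b)) \<in> Trans ?E"
        using loop split_digraph_arcI[OF arcs(1)] by (simp add: Trans_iff[OF refl])
      then show ?thesis by blast
    next
      case 4
      have "arc_class D a (a, b) = arc_class D a (b, a)" "arc_class D b (a, b) = arc_class D b (b, a)"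
        by (rule arc_class_eqI[OF t]; use 4 in simp)+
      then have "(?p a (a, b), ?p b (a, b), ?p c (a, b)) \<in> Trans ?E"
        using 4 loop split_digraph_arcI[OF arcs(1)] split_digraph_arcI[OF arcs(2)]
        by (simp add: Trans_iff[OF refl])
      then show ?thesis by blast
    next
      case 5
      have "arc_class D a (a, b) = arc_class D a (a, c)" "arc_class D b (a, b) = arc_class D b (b, c)"
        "arc_class D c (b, c) = arc_class D c (a, c)"
        by (rule arc_class_eqI[OF t]; use 5 in simp)+
      then have "(?p a (a, c), ?p b (b, c), ?p c (a, c)) \<in> Trans ?E"
        using 5 split_digraph_arcI[OF arcs(1)] split_digraph_arcI[OF arcs(2)]
          split_digraph_arcI[OF arcs(3)]
        by (simp add: Trans_iff[OF refl])
      then show ?thesis by blast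
    qed
    then show ?thesis by force
  qed
  \<comment> \<open>A lifted non-loop has distinct first components, so it stays a non-loop; thus
    \<open>split_arc D\<close> inverts the projection on non-loops.\<close>
  have "parcs (remove_loops ?E) = split_arc D ` parcs (remove_loops D)"
    by (auto simp: split_digraph_def split_arc_def remove_loops_def)
  then have "bij_betw (\<lambda>(P, Q). (fst P, fst Q)) (parcs (remove_loops ?E)) (parcs (remove_loops D))"
    by (intro bij_betw_byWitness[where f' = "split_arc D"])
      (auto simp: split_arc_def)
  with surj hom lift D refl show ?thesis
    unfolding compression_map_def by (intro conjI ballI allI impI)
qed

theorem theorem3p2:
  fixes D :: "'a pair_pre_digraph"
  assumes "stable_digraph D"
  shows "(\<exists>(D2 :: nat pair_pre_digraph) (\<theta> :: nat \<Rightarrow> 'a).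
            preordered_digraph D2 \<and> compression_map D2 D \<theta>) \<longleftrightarrow>
         (\<forall>x\<in>pverts D. clasp D x \<longrightarrow> unlocked_clasp D x)"
proof
  assume "\<exists>(D2 :: nat pair_pre_digraph) (\<theta> :: nat \<Rightarrow> 'a).
    preordered_digraph D2 \<and> compression_map D2 D \<theta>"
  then obtain D2 :: "nat pair_pre_digraph" and \<theta> :: "nat \<Rightarrow> 'a"
    where "preordered_digraph D2" "compression_map D2 D \<theta>" by blast
  from compression_of_preordered_not_locked_clasp[OF this]
  show "\<forall>x\<in>pverts D. clasp D x \<longrightarrow> unlocked_clasp D x"
    by (simp add: unlocked_clasp_def)
next
  assume "\<forall>x\<in>pverts D. clasp D x \<longrightarrow> unlocked_clasp D x"
  then have "\<not> locked_clasp D x" if "x \<in> pverts D" for x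
    using that locked_clasp_imp_clasp[of D x] by (auto simp: unlocked_clasp_def)
  \<comment> \<open>The copies are pairs; finiteness allows renaming them as natural
    numbers.\<close>
  from preordered_split_digraph[OF assms this]
    compression_map_split_digraph[OF stable_imp_reflexive[OF assms]]
  show "\<exists>(D2 :: nat pair_pre_digraph) (\<theta> :: nat \<Rightarrow> 'a).
      preordered_digraph D2 \<and> compression_map D2 D \<theta>"
    by (rule compression_of_preordered_nat)
qed

end
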